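(* Let $p$ be a prime and let $d$ be an integer with $d\mid p-1$ and $1<d<p-1$. Let $\mu_d\subset\mathbb F_p$ be the set of $d$-th roots of unity in $\mathbb F_p$. If $A,B\subseteq\mathbb F_p$ satisfy $A+B=\mu_d$ (where $A+B=\{a+b:a\in A,b\in B\}$) and $|A|,|B|>1$, then $|A|=|B|=\sqrt d$. *)

theory Defs
  imports Complex_Main "HOL-Library.Set_Algebras" "Berlekamp_Zassenhaus.Finite_Field"
begin

definition roots_of_unity :: "nat \<Rightarrow> 'a::monoid_mult set"
  where "roots_of_unity d = {x. x ^ d = 1}"

end

theory Submission
  imports Defs "HOL-Computational_Algebra.Polynomial_FPS"
begin

text \<open>
  Put \<open>R = -A\<close>, \<open>m = |A|\<close>, \<open>n = |B|\<close>, and let \<open>f\<close>, \<open>g\<close> be the monic polynomials with simple roots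
  \<open>R\<close> and \<open>B\<close>. Stepanov's method in the form of Hanson and Petridis: with the Lagrange weights
  \<open>w r\<close> of \<open>R\<close>, the polynomial \<open>F = (\<Sum>r\<in>R. w r * (x - r) ^ (d + m - 1)) - const\<close> has degree \<open>d\<close> and
  vanishes to order \<open>m\<close> at every point of \<open>B\<close>. Hence \<open>m * n \<le> d\<close>, so \<open>m * n = d\<close>, all sums
  \<open>a + b\<close> are distinct, and \<open>F = C * g ^ m\<close>.

  Comparing the Taylor coefficients of orders \<open>m\<close> and \<open>m + 1\<close> of both sides at \<open>b \<in> B\<close> yields
  \<open>m (m + 1) f g'' = 2 (d - 1) f' g'\<close> at \<open>b\<close>; symmetrically \<open>n (n + 1) f'' g = 2 (d - 1) f' g'\<close> on \<open>R\<close>.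
  So \<open>m (m + 1) f g'' + n (n + 1) f'' g - 2 (d - 1) f' g'\<close>, of degree less than \<open>m + n\<close>, vanishes on
  \<open>R \<union> B\<close> and is zero.

  Translate so that \<open>R\<close> has sum \<open>0\<close>, and let \<open>k\<close> be the least positive exponent for which the
  \<open>k\<close>-th power sum of \<open>R\<close> or \<open>B\<close> is nonzero. As the \<open>k\<close>-th power sum of the \<open>d\<close>-th roots of unity
  vanishes, the coefficients \<open>\<phi>\<close>, \<open>\<gamma>\<close> of \<open>f\<close>, \<open>g\<close> just below the leading ones satisfy
  \<open>m \<gamma> = - (-1) ^ k n \<phi>\<close>. The first nontrivial coefficient of the differential identity then reads
  \<open>(n - m) (k + 3) = 0\<close> for even \<open>k\<close> and \<open>(k - 1) (m + n + 2) = 0\<close> for odd \<open>k\<close>; the latter is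
  impossible, and the former gives \<open>m = n\<close>.
\<close>

section \<open>Monic polynomials with prescribed simple roots\<close>

definition root_poly :: "'a::field set \<Rightarrow> 'a poly"
  where "root_poly S = (\<Prod>s\<in>S. [:- s, 1:])"

lemma root_poly_nonzero [simp]: "root_poly S \<noteq> 0"
  by (cases "finite S") (auto simp: root_poly_def)

lemma degree_root_poly [simp]: "degree (root_poly S) = card S"
  by (simp add: root_poly_def degree_prod_sum_eq)

lemma coeff_root_poly_card [simp]: "coeff (root_poly S) (card S) = 1"
proof -
  have "lead_coeff (root_poly S) = 1"
    unfolding root_poly_def by (subst lead_coeff_prod) simp
  then show ?thesis by simp
qed

lemma poly_root_poly: "poly (root_poly S) x = (\<Prod>s\<in>S. x - s)"
  by (simp add: root_poly_def poly_prod)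

lemma poly_root_poly_eq_0_iff:
  "finite S \<Longrightarrow> poly (root_poly S) x = 0 \<longleftrightarrow> x \<in> S"
  by (auto simp: poly_root_poly)

lemma root_poly_remove:
  "finite S \<Longrightarrow> s \<in> S \<Longrightarrow> root_poly S = [:- s, 1:] * root_poly (S - {s})"
  unfolding root_poly_def by (rule prod.remove)

lemma of_nat_neq_0_if_less_CHAR:
  "0 < k \<Longrightarrow> k < CHAR('a) \<Longrightarrow> of_nat k \<noteq> (0 :: 'a::semiring_1)"
  by (auto simp: of_nat_eq_0_iff_char_dvd dest: dvd_imp_le)

text \<open>The binomial coefficient divides \<open>fact n\<close>, a product of factors below the
  characteristic and hence nonzero in the field.\<close>

lemma of_nat_binomial_neq_0:
  assumes "k \<le> n" "n < CHAR('a::idom)"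
  shows "of_nat (n choose k) \<noteq> (0 :: 'a)"
proof -
  have *: "of_nat (fact j) \<noteq> (0 :: 'a)" if "j < CHAR('a)" for j
    using that
  proof (induction j)
    case (Suc j)
    then show ?case
      using of_nat_neq_0_if_less_CHAR[of "Suc j", where 'a='a]
      by (simp only: fact_Suc of_nat_id of_nat_mult mult_eq_0_iff) auto
  qed auto
  have "of_nat (fact k * fact (n - k) * (n choose k)) = (of_nat (fact n) :: 'a)"
    by (subst binomial_fact_lemma) (use assms in auto)
  with *[of n] assms show ?thesis by (metis mult_zero_right of_nat_mult)
qed

section \<open>Lagrange weights and partial fractions\<close>

text \<open>For \<open>s\<close> in a finite \<open>S\<close> this is the reciprocal of the
  derivative of \<open>root_poly S\<close> at \<open>s\<close>, the barycentric weight of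
  interpolation.\<close>

definition lagrange_weight :: "'a::field set \<Rightarrow> 'a \<Rightarrow> 'a"
  where "lagrange_weight S s = inverse (poly (root_poly (S - {s})) s)"

lemma lagrange_interpolation:
  assumes "finite S" and "degree p < card S"
  shows "p = (\<Sum>s\<in>S. smult (lagrange_weight S s * poly p s) (root_poly (S - {s})))"
    (is "_ = ?q")
proof (rule poly_eqI_degree[of S])
  fix x assume x: "x \<in> S"
  have "poly ?q x = (\<Sum>s\<in>{x}. lagrange_weight S s * poly p s * poly (root_poly (S - {s})) x)"
    unfolding poly_sum poly_smult
    by (rule sum.mono_neutral_right) (use assms x in \<open>auto simp: poly_root_poly_eq_0_iff\<close>)
  also have "\<dots> = poly p x"
    using assms(1) by (simp add: lagrange_weight_def poly_root_poly_eq_0_iff)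
  finally show "poly p x = poly ?q x" by simp
next
  have "degree (smult (lagrange_weight S s * poly p s) (root_poly (S - {s}))) \<le> card S - 1"
    if "s \<in> S" for s
    using that assms by (intro order.trans[OF degree_smult_le]) simp
  then have "degree ?q \<le> card S - 1"
    by (intro degree_sum_le) (use assms in auto)
  then show "card S > degree ?q" using assms by linarith
qed (use assms in auto)

text \<open>Compare coefficients of degree \<open>card S - 1\<close> in the interpolation formula:
  each \<open>root_poly (S - {s})\<close> is monic of exactly that degree.\<close>

lemma sum_lagrange_weight:
  assumes "finite S" and "degree p < card S"
  shows "(\<Sum>s\<in>S. lagrange_weight S s * poly p s) = coeff p (card S - 1)"
proof -
  have 1: "coeff (root_poly (S - {s})) (card S - 1) = 1" if "s \<in> S" for s
    using coeff_root_poly_card[of "S - {s}"] that assms(1) by simp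
  show ?thesis
    by (subst (2) lagrange_interpolation[OF assms]) (simp add: coeff_sum 1 [simplified])
qed

text \<open>Here \<open>(x - s) ^ k\<close> is read as a polynomial in \<open>s\<close>, with
  leading coefficient \<open>(-1) ^ k\<close>.\<close>

lemma sum_lagrange_weight_power:
  assumes "finite S" and "k < card S"
  shows "(\<Sum>s\<in>S. lagrange_weight S s * (x - s) ^ k)
          = (if k = card S - 1 then (-1) ^ k else 0)"
proof -
  have deg: "degree ([:x, - 1:] ^ k) \<le> k"
    by (rule order.trans[OF degree_power_le]) simp
  have "(\<Sum>s\<in>S. lagrange_weight S s * (x - s) ^ k)
        = (\<Sum>s\<in>S. lagrange_weight S s * poly ([:x, - 1:] ^ k) s)"
    by (simp add: poly_power)
  also have "\<dots> = coeff ([:x, - 1:] ^ k) (card S - 1)"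
    by (rule sum_lagrange_weight) (use deg assms in auto)
  also have "\<dots> = (if k = card S - 1 then (-1) ^ k else 0)"
    using assms deg by (auto simp: coeff_linear_poly_power intro: coeff_eq_0)
  finally show ?thesis .
qed

text \<open>Interpolating the constant 1 gives the partial fractions of the reciprocal of
  \<open>root_poly S\<close>; differentiating that interpolation formula gives the second
  identity.\<close>

lemma sum_lagrange_weight_divide:
  assumes "finite S" "S \<noteq> {}" "x \<notin> S"
  shows "poly (root_poly S) x * (\<Sum>s\<in>S. lagrange_weight S s / (x - s)) = 1"
    and "poly (root_poly S) x * (\<Sum>s\<in>S. lagrange_weight S s / (x - s)\<^sup>2)
          = poly (pderiv (root_poly S)) x * (\<Sum>s\<in>S. lagrange_weight S s / (x - s))"
proof -
  let ?w = "lagrange_weight S" and ?T = "\<lambda>s. root_poly (S - {s})" and ?f = "root_poly S"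
  have one: "1 = (\<Sum>s\<in>S. smult (?w s) (?T s))"
    by (subst lagrange_interpolation[of S 1])
       (use assms in \<open>auto simp: card_gt_0_iff\<close>)
  have T: "poly (?T s) x = poly ?f x / (x - s)" if "s \<in> S" for s
  proof -
    have "x - s \<noteq> 0" using that assms by auto
    moreover have "poly ?f x = (x - s) * poly (?T s) x"
      using that assms by (subst root_poly_remove[of S s]) (auto simp: algebra_simps)
    ultimately show ?thesis by simp
  qed
  have T': "poly (pderiv (?T s)) x = poly (pderiv ?f) x / (x - s) - poly ?f x / (x - s)\<^sup>2"
    if "s \<in> S" for s
  proof -
    have "x - s \<noteq> 0" using that assms by auto
    moreover have "poly (pderiv ?f) x = (x - s) * poly (pderiv (?T s)) x + poly (?T s) x"
      using that assms by (subst root_poly_remove[of S s]) (auto simp: pderiv_mult pderiv_pCons simp del: mult_pCons_left)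
    ultimately show ?thesis
      unfolding T[OF that] by (simp add: divide_simps power2_eq_square)
  qed
  have "1 = (\<Sum>s\<in>S. ?w s * poly (?T s) x)"
    using arg_cong[OF one, of "\<lambda>p. poly p x"] by (simp add: poly_sum)
  then show "poly ?f x * (\<Sum>s\<in>S. ?w s / (x - s)) = 1"
    by (simp add: T sum_distrib_left mult_ac)
  have "0 = (\<Sum>s\<in>S. ?w s * poly (pderiv (?T s)) x)"
    using arg_cong[OF one, of "\<lambda>p. poly (pderiv p) x"]
    by (simp add: pderiv_sum pderiv_smult poly_sum)
  also have "\<dots> = poly (pderiv ?f) x * (\<Sum>s\<in>S. ?w s / (x - s))
                 - poly ?f x * (\<Sum>s\<in>S. ?w s / (x - s)\<^sup>2)"
    unfolding sum_distrib_left sum_subtractf[symmetric]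
    by (intro sum.cong refl) (simp add: T' right_diff_distrib mult_ac)
  finally show "poly ?f x * (\<Sum>s\<in>S. ?w s / (x - s)\<^sup>2)
      = poly (pderiv ?f) x * (\<Sum>s\<in>S. ?w s / (x - s))" by simp
qed

section \<open>Orders of vanishing and Taylor coefficients\<close>

lemma linear_power_dvd_if_coeff_pcompose_eq_0:
  fixes p :: "'a::field poly"
  assumes "\<And>k. k < m \<Longrightarrow> coeff (pcompose p [:b, 1:]) k = 0"
  shows "[:- b, 1:] ^ m dvd p"
proof -
  have "monom 1 m dvd pcompose p [:b, 1:]"
    using assms by (simp add: monom_1_dvd_iff')
  then obtain q where q: "pcompose p [:b, 1:] = monom 1 m * q" ..
  have "p = pcompose (pcompose p [:b, 1:]) [:- b, 1:]"
    by (simp add: pcompose_assoc[symmetric] pcompose_pCons)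
  also have "\<dots> = [:- b, 1:] ^ m * pcompose q [:- b, 1:]"
    by (simp add: q pcompose_mult monom_altdef pcompose_hom.hom_power pcompose_pCons)
  finally show ?thesis by (metis dvd_triv_left)
qed

text \<open>Induction over the roots: a new root \<open>s\<close> has order 0 in the factor already
  split off, so its whole multiplicity lies in the cofactor.\<close>

lemma root_poly_power_dvd:
  fixes p :: "'a::field poly"
  assumes "finite S" and "\<And>s. s \<in> S \<Longrightarrow> [:- s, 1:] ^ m dvd p"
  shows "root_poly S ^ m dvd p"
proof (cases "p = 0")
  case False
  from assms show ?thesis
  proof (induction S)
    case (insert s S)
    then obtain q where q: "p = root_poly S ^ m * q" by (auto elim: dvdE)
    have "order s (root_poly S ^ m) = 0"
      by (rule order_0I) (use insert in \<open>simp add: poly_power poly_root_poly_eq_0_iff\<close>)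
    with insert.prems[of s] False have "[:- s, 1:] ^ m dvd q"
      by (auto simp: q order_divides order_mult)
    moreover have "root_poly (insert s S) ^ m = root_poly S ^ m * [:- s, 1:] ^ m"
      unfolding root_poly_def
      by (simp only: prod.insert[OF insert.hyps(1,2)] power_mult_distrib mult.commute)
    ultimately show ?case by (simp only: q mult_dvd_mono dvd_refl)
  qed (simp add: root_poly_def)
qed simp

lemma coeff_pcompose_shift_1:
  "coeff (pcompose p [:b, 1:]) 1 = poly (pderiv p) (b :: 'a::idom)"
proof -
  have "coeff (pderiv (pcompose p [:b, 1:])) 0 = poly (pderiv p) b"
    by (simp add: pderiv_pcompose pderiv_pCons)
  then show ?thesis by (simp add: coeff_pderiv)
qed

lemma coeff_pcompose_shift_2:
  "2 * coeff (pcompose p [:b, 1:]) 2 = poly (pderiv (pderiv p)) (b :: 'a::idom)"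
proof -
  have "coeff (pderiv (pderiv (pcompose p [:b, 1:]))) 0 = poly (pderiv (pderiv p)) b"
    by (simp add: pderiv_pcompose pderiv_pCons)
  then show ?thesis by (simp add: coeff_pderiv numeral_2_eq_2)
qed

text \<open>With \<open>p = X * q\<close> these are the constant and the linear coefficient of
  \<open>q ^ m\<close>; the latter is read off the derivative.\<close>

lemma coeff_power_of_zero_constant_term:
  fixes p :: "'a::idom poly"
  assumes "coeff p 0 = 0"
  shows "coeff (p ^ m) m = coeff p 1 ^ m"
    and "coeff (p ^ m) (Suc m) = of_nat m * coeff p 1 ^ (m - 1) * coeff p 2"
proof -
  obtain q where q: "p = pCons 0 q"
    using assms by (cases p rule: pCons_cases) auto
  have pm: "p ^ m = monom 1 m * q ^ m"
    by (simp add: q monom_altdef flip: power_mult_distrib)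
  have "coeff (q ^ m) 1 = of_nat m * coeff q 0 ^ (m - 1) * coeff q 1"
    using coeff_pderiv[of "q ^ m" 0]
    by (simp add: pderiv_power coeff_mult coeff_0_power coeff_pderiv mult.assoc)
  then show "coeff (p ^ m) m = coeff p 1 ^ m"
    "coeff (p ^ m) (Suc m) = of_nat m * coeff p 1 ^ (m - 1) * coeff p 2"
    unfolding pm by (simp_all add: coeff_monom_mult q coeff_0_power numeral_2_eq_2)
qed

lemma coeff_pcompose_sum_linear_power:
  fixes w :: "'a \<Rightarrow> 'a::field"
  assumes "k \<le> N"
  shows "coeff (pcompose ((\<Sum>s\<in>S. smult (w s) ([:- s, 1:] ^ N)) - [:a:]) [:x, 1:]) k
          = of_nat (N choose k) * (\<Sum>s\<in>S. w s * (x - s) ^ (N - k)) - (if k = 0 then a else 0)"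
proof -
  have "pcompose ((\<Sum>s\<in>S. smult (w s) ([:- s, 1:] ^ N)) - [:a:]) [:x, 1:]
        = (\<Sum>s\<in>S. smult (w s) ([:x - s, 1:] ^ N)) - [:a:]"
    by (simp add: pcompose_diff pcompose_sum pcompose_smult pcompose_hom.hom_power pcompose_pCons)
  then show ?thesis
    using assms
    by (simp add: coeff_sum coeff_linear_poly_power sum_distrib_left mult_ac coeff_pCons
          split: nat.splits)
qed

section \<open>The Stepanov polynomial\<close>

context
  fixes R B :: "'a::field set" and c :: 'a and d :: nat
  assumes fin: "finite R" "finite B" and R_nonempty: "R \<noteq> {}"
    and pow: "\<And>r b. r \<in> R \<Longrightarrow> b \<in> B \<Longrightarrow> (b - r) ^ d = c"
    and c: "c \<noteq> 0" and d: "2 \<le> d" and char: "d + card R \<le> CHAR('a)"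
begin

text \<open>The exponent \<open>d + card R - 1\<close> makes the weights act twice. They cancel all
  coefficients above degree \<open>d\<close>; and at a point of \<open>B\<close>, where
  \<open>(b - r) ^ d = c\<close>, they cancel the Taylor coefficients of orders below
  \<open>card R\<close> except that of order 0, which the constant removes.\<close>

definition "stepanov_poly = (\<Sum>r\<in>R. smult (lagrange_weight R r) ([:- r, 1:] ^ (d + card R - 1)))
  - [:c * (-1) ^ (card R - 1):]"

private lemma card_R: "card R \<ge> 1"
  using fin R_nonempty by (simp add: Suc_le_eq card_gt_0_iff)

lemma degree_stepanov_poly: "degree stepanov_poly \<le> d"
  and coeff_stepanov_poly: "coeff stepanov_poly d \<noteq> 0"
proof -
  let ?N = "d + card R - 1"
  have cf: "coeff stepanov_poly k
      = of_nat (?N choose k) * (\<Sum>s\<in>R. lagrange_weight R s * (0 - s) ^ (?N - k))"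
    if "k \<le> ?N" "k > 0" for k
    using coeff_pcompose_sum_linear_power[OF that(1), of "lagrange_weight R" R
        "c * (-1) ^ (card R - 1)" 0] that
    by (simp add: stepanov_poly_def)
  have "degree stepanov_poly \<le> ?N"
    unfolding stepanov_poly_def
    by (intro degree_diff_le degree_sum_le fin order.trans[OF degree_smult_le]
        order.trans[OF degree_power_le]) auto
  moreover have "coeff stepanov_poly k = 0" if "k > d" "k \<le> ?N" for k
    using that card_R d
    by (subst cf) (auto simp: sum_lagrange_weight_power[OF fin(1)] simp del: diff_0)
  ultimately have "coeff stepanov_poly k = 0" if "k > d" for k
    using that by (cases "k \<le> ?N") (auto intro: coeff_eq_0)
  then show "degree stepanov_poly \<le> d" by (intro degree_le) auto
  show "coeff stepanov_poly d \<noteq> 0"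
  proof -
    have "?N - d = card R - 1" using card_R by simp
    then have "coeff stepanov_poly d = of_nat (?N choose d) * (-1) ^ (card R - 1)"
      using cf[of d] card_R d sum_lagrange_weight_power[OF fin(1), of "card R - 1" 0] by simp
    moreover have "of_nat (?N choose d) \<noteq> (0 :: 'a)"
      using card_R d char by (intro of_nat_binomial_neq_0) auto
    ultimately show ?thesis by simp
  qed
qed

lemma coeff_stepanov_poly_at:
  assumes "b \<in> B" "k \<le> card R + 1"
  shows "coeff (pcompose stepanov_poly [:b, 1:]) k = (if k < card R then 0 else
    of_nat ((d + card R - 1) choose k) * c * (\<Sum>r\<in>R. lagrange_weight R r / (b - r) ^ (k + 1 - card R)))"
proof -
  let ?N = "d + card R - 1"
  have nz: "b - r \<noteq> 0" if "r \<in> R" for r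
    using pow[OF that assms(1)] c d by (auto simp: power_0_left)
  have cf: "coeff (pcompose stepanov_poly [:b, 1:]) k
      = of_nat (?N choose k) * (\<Sum>r\<in>R. lagrange_weight R r * (b - r) ^ (?N - k))
        - (if k = 0 then c * (-1) ^ (card R - 1) else 0)"
    unfolding stepanov_poly_def
    by (rule coeff_pcompose_sum_linear_power) (use assms d in auto)
  show ?thesis
  proof (cases "k < card R")
    case True
    \<comment> \<open>For \<open>k < card R\<close> the exponent is at least \<open>d\<close>, so a
      factor \<open>c\<close> splits off and a power of degree below \<open>card R\<close>
      remains.\<close>
    then have "?N - k = d + (card R - 1 - k)" by simp
    then have "(\<Sum>r\<in>R. lagrange_weight R r * (b - r) ^ (?N - k))
        = c * (\<Sum>r\<in>R. lagrange_weight R r * (b - r) ^ (card R - 1 - k))"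
      by (simp add: power_add pow assms sum_distrib_left mult_ac)
    also have "\<dots> = (if k = 0 then c * (-1) ^ (card R - 1) else 0)"
      using True card_R by (subst sum_lagrange_weight_power[OF fin(1)]) auto
    finally show ?thesis using True cf by auto
  next
    case False
    \<comment> \<open>Now the exponent is \<open>d - (k + 1 - card R)\<close>. The subtraction does
      not truncate, since \<open>k + 1 - card R \<le> 2 \<le> d\<close>.\<close>
    have "(b - r) ^ (?N - k) = c / (b - r) ^ (k + 1 - card R)" if "r \<in> R" for r
    proof -
      have "(b - r) ^ (?N - k) * (b - r) ^ (k + 1 - card R) = c"
        using False assms d card_R
        by (subst power_add[symmetric], subst pow[OF that assms(1), symmetric])
           (intro arg_cong[of _ _ "power (b - r)"], simp)
      then show ?thesis using nz[OF that] by (simp add: field_simps)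
    qed
    with False cf card_R show ?thesis
      by (simp add: sum_distrib_left mult_ac)
  qed
qed

lemma root_poly_power_dvd_stepanov_poly: "root_poly B ^ card R dvd stepanov_poly"
proof (rule root_poly_power_dvd[OF fin(2)], rule linear_power_dvd_if_coeff_pcompose_eq_0)
  fix b k assume "b \<in> B" "k < card R"
  then show "coeff (pcompose stepanov_poly [:b, 1:]) k = 0"
    using coeff_stepanov_poly_at[of b k] by simp
qed

lemma card_mult_card_le: "card R * card B \<le> d"
proof -
  have "stepanov_poly \<noteq> 0" using coeff_stepanov_poly by auto
  then have "degree (root_poly B ^ card R) \<le> degree stepanov_poly"
    by (intro dvd_imp_degree_le root_poly_power_dvd_stepanov_poly)
  then show ?thesis
    using degree_stepanov_poly by (simp add: degree_power_eq mult.commute)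
qed

text \<open>The two lowest Taylor coefficients of \<open>stepanov_poly\<close> at \<open>b\<close>
  are computed once from the weights and once from its factorization; dividing one equation by the
  other eliminates the unknown factor \<open>C\<close>.\<close>

lemma second_order_relation:
  assumes eq: "card R * card B = d" and b: "b \<in> B"
  shows "of_nat (card R * (card R + 1)) * poly (root_poly R) b * poly (pderiv (pderiv (root_poly B))) b
    = of_nat (2 * (d - 1)) * poly (pderiv (root_poly R)) b * poly (pderiv (root_poly B)) b"
proof -
  define m where "m = card R"
  let ?N = "d + m - 1" and ?g = "root_poly B" and ?f = "root_poly R"
  let ?G = "pcompose (root_poly B) [:b, 1:]"
  let ?S = "\<lambda>j. \<Sum>r\<in>R. lagrange_weight R r / (b - r) ^ j"
  have m: "m \<ge> 1" using card_R by (simp add: m_def)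
  have bR: "b \<notin> R"
    using pow[OF _ b, of b] c d by (auto simp: power_0_left)
  obtain q where q: "stepanov_poly = ?g ^ m * q"
    using root_poly_power_dvd_stepanov_poly by (auto simp: m_def)
  have "q \<noteq> 0" using q coeff_stepanov_poly by auto
  \<comment> \<open>\<open>root_poly B ^ card R\<close> already has degree \<open>d\<close>, so the
    cofactor is constant.\<close>
  then have "degree q = 0"
    using degree_stepanov_poly eq by (simp add: q degree_mult_eq degree_power_eq m_def mult.commute)
  then obtain C where C: "q = [:C:]" by (rule degree_eq_zeroE)
  have F: "pcompose stepanov_poly [:b, 1:] = smult C (?G ^ m)"
    by (simp add: q C pcompose_smult pcompose_hom.hom_power)
  have "coeff ?G 0 = 0"
    using fin b by (simp add: poly_root_poly_eq_0_iff)
  note G = coeff_power_of_zero_constant_term[OF this, of m]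
  let ?u = "coeff ?G 1" and ?v = "coeff ?G 2"
  have 1: "C * ?u ^ m = of_nat (?N choose m) * c * ?S 1"
    using coeff_stepanov_poly_at[OF b, of m] unfolding F m_def[symmetric] coeff_smult G by simp
  have 2: "C * (of_nat m * ?u ^ (m - 1) * ?v) = of_nat (?N choose (m + 1)) * c * ?S 2"
    using coeff_stepanov_poly_at[OF b, of "m + 1"]
    unfolding F m_def[symmetric] coeff_smult G Suc_eq_plus1[symmetric] by (simp add: numeral_2_eq_2)
  have S1: "poly ?f b * ?S 1 = 1" and S2: "poly ?f b * ?S 2 = poly (pderiv ?f) b * ?S 1"
    using sum_lagrange_weight_divide[OF fin(1) R_nonempty bR] by simp_all
  have "of_nat (?N choose m) \<noteq> (0 :: 'a)"
    by (rule of_nat_binomial_neq_0) (use char d m in \<open>auto simp: m_def\<close>)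
  then have "C * ?u ^ m \<noteq> 0" using 1 S1 c by auto
  then have nz: "C * ?u ^ (m - 1) \<noteq> 0" using m by (cases m) auto
  \<comment> \<open>The ratio of consecutive binomials, with \<open>?N - m = d - 1\<close>, is the
    source of the factor \<open>d - 1\<close>.\<close>
  have "(m + 1) * (?N choose (m + 1)) = (d - 1) * (?N choose m)"
    using binomial_absorb_comp[of ?N m] binomial_absorption[of m ?N] d
    by (simp only: Suc_eq_plus1) simp
  then have bin: "of_nat (m + 1) * of_nat (?N choose (m + 1)) = (of_nat (d - 1) * of_nat (?N choose m) :: 'a)"
    by (metis of_nat_mult)
  have "C * ?u ^ (m - 1) * (of_nat (m * (m + 1)) * poly ?f b * ?v)
      = of_nat (m + 1) * poly ?f b * (C * (of_nat m * ?u ^ (m - 1) * ?v))"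
    by (simp only: of_nat_mult mult_ac)
  also have "\<dots> = (of_nat (m + 1) * of_nat (?N choose (m + 1))) * c * (poly ?f b * ?S 2)"
    unfolding 2 by (simp add: mult_ac)
  also have "\<dots> = of_nat (d - 1) * poly (pderiv ?f) b * (of_nat (?N choose m) * c * ?S 1)"
    unfolding S2 bin by (simp add: mult_ac)
  also have "\<dots> = C * ?u ^ (m - 1) * (of_nat (d - 1) * poly (pderiv ?f) b * ?u)"
    unfolding 1[symmetric] using m by (cases m) (auto simp: mult_ac)
  finally have "of_nat (m * (m + 1)) * poly ?f b * ?v = of_nat (d - 1) * poly (pderiv ?f) b * ?u"
    by (simp only: mult_left_cancel[OF nz])
  then have "of_nat (m * (m + 1)) * poly ?f b * (2 * ?v) = of_nat (2 * (d - 1)) * poly (pderiv ?f) b * ?u"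
    by (simp add: mult_ac)
  then show ?thesis
    unfolding coeff_pcompose_shift_1 coeff_pcompose_shift_2 m_def .
qed

end

section \<open>The differential identity\<close>

lemma degree_pderiv_le: "degree (pderiv p) \<le> degree p - 1"
  by (intro degree_le) (auto simp: coeff_pderiv intro!: coeff_eq_0 simp del: of_nat_Suc)

lemma root_poly_differential_identity:
  fixes R B :: "'a::field set" and c :: 'a and d :: nat
  assumes fin: "finite R" "finite B" and ne: "R \<noteq> {}" "B \<noteq> {}"
    and pow: "\<And>r b. r \<in> R \<Longrightarrow> b \<in> B \<Longrightarrow> (b - r) ^ d = c"
    and c: "c \<noteq> 0" and d: "2 \<le> d" "card R * card B = d"
    and char: "d + card R \<le> CHAR('a)" "d + card B \<le> CHAR('a)"
  defines "f \<equiv> root_poly R" and "g \<equiv> root_poly B"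
  shows "smult (of_nat (card R * (card R + 1))) (f * pderiv (pderiv g))
    + smult (of_nat (card B * (card B + 1))) (pderiv (pderiv f) * g)
    = smult (of_nat (2 * (d - 1))) (pderiv f * pderiv g)" (is "?lhs = ?rhs")
proof (rule poly_eqI_degree[of "R \<union> B"])
  have disj: "R \<inter> B = {}"
    using pow c d(1) by (auto simp: disjoint_iff) (metis cancel_comm_monoid_add_class.diff_cancel
        power_0_left not_numeral_le_zero)
  have m: "1 \<le> card R" "1 \<le> card B"
    using fin ne by (simp_all add: Suc_le_eq card_gt_0_iff)
  have card: "card (R \<union> B) = card R + card B"
    using fin disj by (rule card_Un_disjoint)
  have d1: "degree (pderiv f) \<le> card R - 1" "degree (pderiv g) \<le> card B - 1"
    using degree_pderiv_le[of f] degree_pderiv_le[of g] by (simp_all add: f_def g_def)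
  have d2: "degree (pderiv (pderiv f)) \<le> card R - 1" "degree (pderiv (pderiv g)) \<le> card B - 1"
    using d1 degree_pderiv_le[of "pderiv f"] degree_pderiv_le[of "pderiv g"] by linarith+
  have deg: "degree f = card R" "degree g = card B" by (simp_all add: f_def g_def)
  have "degree ?lhs \<le> card R + card B - 1"
  proof (intro degree_add_le order.trans[OF degree_smult_le] order.trans[OF degree_mult_le])
    show "degree f + degree (pderiv (pderiv g)) \<le> card R + card B - 1"
      using deg d2 m by linarith
    show "degree (pderiv (pderiv f)) + degree g \<le> card R + card B - 1"
      using deg d2 m by linarith
  qed
  then show "degree ?lhs < card (R \<union> B)" using card m by linarith
  have "degree ?rhs \<le> card R + card B - 1"
    using d1 m by (intro order.trans[OF degree_smult_le] order.trans[OF degree_mult_le]) linarith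
  then show "degree ?rhs < card (R \<union> B)" using card m by linarith
  fix x assume "x \<in> R \<union> B"
  then show "poly ?lhs x = poly ?rhs x"
  proof
    assume x: "x \<in> B"
    then have "poly g x = 0" using fin by (simp add: g_def poly_root_poly_eq_0_iff)
    moreover note second_order_relation[OF fin ne(1) pow c d(1) char(1) d(2) x, folded f_def g_def]
    ultimately show ?thesis by (simp add: mult.assoc)
  next
    assume x: "x \<in> R"
    then have "poly f x = 0" using fin by (simp add: f_def poly_root_poly_eq_0_iff)
    \<comment> \<open>Exchanging \<open>R\<close> and \<open>B\<close> changes the constant by this
      sign, which is why \<open>c\<close> is kept general.\<close>
    moreover have "(b - a) ^ d = (- 1) ^ d * c" if "b \<in> R" "a \<in> B" for a b
      using pow[OF that] by (metis minus_diff_eq power_minus)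
    then have "of_nat (card B * (card B + 1)) * poly g x * poly (pderiv (pderiv f)) x
        = of_nat (2 * (d - 1)) * poly (pderiv g) x * poly (pderiv f) x"
      unfolding f_def g_def
      by (intro second_order_relation[where c = "(- 1) ^ d * c"])
         (use assms x in \<open>auto simp: mult.commute\<close>)
    ultimately show ?thesis by (simp add: mult_ac)
  qed
qed

section \<open>Newton's identities and power sums\<close>

lemma coeff_reflect_root_poly:
  "coeff (reflect_poly (root_poly S)) k = (if k \<le> card S then coeff (root_poly S) (card S - k) else 0)"
  by (auto simp: coeff_reflect_poly)

text \<open>Logarithmic derivative: \<open>Q\<close> is the product of the \<open>1 - s * X\<close>,
  so \<open>Q' = - Q * (\<Sum>s\<in>S. L s)\<close>, where \<open>L s\<close> is the power series of
  \<open>s / (1 - s * X)\<close>.\<close>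

lemma root_poly_newton:
  fixes S :: "'a::field set"
  assumes "finite S"
  defines "Q \<equiv> reflect_poly (root_poly S)"
  shows "of_nat (Suc k) * coeff Q (Suc k) = - (\<Sum>i\<le>k. coeff Q i * (\<Sum>s\<in>S. s ^ Suc (k - i)))"
proof -
  define L where "L = (\<lambda>s :: 'a. Abs_fps (\<lambda>i. s ^ Suc i))"
  have L: "(1 - fps_const s * fps_X) * L s = fps_const s" for s
    by (rule fps_ext) (auto simp: L_def left_diff_distrib mult.assoc gr0_conv_Suc)
  have Q: "Q = (\<Prod>s\<in>S. [:1, - s:])"
    unfolding Q_def root_poly_def reflect_poly_prod
    by (intro prod.cong refl) (simp add: reflect_poly_pCons' monom_altdef)
  have "fps_deriv (fps_of_poly (\<Prod>s\<in>S. [:1, - s:]))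
      = - fps_of_poly (\<Prod>s\<in>S. [:1, - s:]) * (\<Sum>s\<in>S. L s)"
    using assms(1)
  proof (induction S)
    case (insert s S)
    let ?P = "fps_of_poly (\<Prod>s\<in>S. [:1, - s:])"
    have "fps_of_poly [:1, - s:] = 1 - fps_const s * fps_X"
      by (rule fps_ext) (auto simp: coeff_pCons fps_X_def split: nat.splits)
    then have P: "fps_of_poly (\<Prod>s\<in>insert s S. [:1, - s:]) = (1 - fps_const s * fps_X) * ?P"
      by (simp only: prod.insert[OF insert.hyps(1,2)] fps_of_poly_mult)
    have "fps_deriv ((1 - fps_const s * fps_X) * ?P)
        = - (fps_const s * ?P) - (1 - fps_const s * fps_X) * ?P * (\<Sum>s\<in>S. L s)"
      by (simp add: insert.IH algebra_simps)
    also have "\<dots> = - ((1 - fps_const s * fps_X) * ?P) * (L s + (\<Sum>s\<in>S. L s))"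
      using arg_cong[OF L[of s], of "\<lambda>q. q * ?P"] by (simp add: algebra_simps)
    finally show ?case using insert.hyps unfolding P by simp
  qed simp
  then have "fps_nth (fps_deriv (fps_of_poly Q)) k = fps_nth (- fps_of_poly Q * (\<Sum>s\<in>S. L s)) k"
    by (simp add: Q)
  then show ?thesis
    by (simp add: fps_mult_nth L_def fps_sum_nth atMost_atLeast0 sum_negf algebra_simps)
qed

lemma coeff_reflect_root_poly_if_power_sums_0:
  assumes "finite S" "0 < k" "\<And>j. 0 < j \<Longrightarrow> j < k \<Longrightarrow> (\<Sum>s\<in>S. s ^ j) = (0 :: 'a::field)"
  shows "of_nat k * coeff (reflect_poly (root_poly S)) k = - (\<Sum>s\<in>S. s ^ k)"
proof -
  obtain k' where k: "k = Suc k'" using assms(2) by (cases k) auto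
  have "(\<Sum>i\<le>k'. coeff (reflect_poly (root_poly S)) i * (\<Sum>s\<in>S. s ^ Suc (k' - i)))
      = (\<Sum>i\<in>{0}. coeff (reflect_poly (root_poly S)) i * (\<Sum>s\<in>S. s ^ Suc (k' - i)))"
    \<comment> \<open>Only the term \<open>i = 0\<close> survives, and there the coefficient is the
      leading one of \<open>root_poly S\<close>, namely 1.\<close>
    by (rule sum.mono_neutral_right) (use assms(3) in \<open>auto simp: k simp del: power_Suc\<close>)
  then show ?thesis
    unfolding k root_poly_newton[OF assms(1)] by simp
qed

lemma power_sum_eq_0_if_coeff_reflect_root_poly_0:
  assumes "finite S" "0 < k" "\<And>j. 0 < j \<Longrightarrow> j \<le> k \<Longrightarrow> coeff (reflect_poly (root_poly S)) j = 0"
  shows "(\<Sum>s\<in>S. s ^ k) = (0 :: 'a::field)"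
proof -
  obtain k' where k: "k = Suc k'" using assms(2) by (cases k) auto
  have "(\<Sum>i\<le>k'. coeff (reflect_poly (root_poly S)) i * (\<Sum>s\<in>S. s ^ Suc (k' - i)))
      = (\<Sum>i\<in>{0}. coeff (reflect_poly (root_poly S)) i * (\<Sum>s\<in>S. s ^ Suc (k' - i)))"
    by (rule sum.mono_neutral_right) (use assms(3) in \<open>auto simp: k simp del: power_Suc\<close>)
  then show ?thesis
    using root_poly_newton[OF assms(1), of k'] assms(3)[of k] unfolding k by simp
qed

text \<open>In the binomial expansion every mixed term contains a power sum of \<open>B\<close> of
  exponent strictly between 0 and \<open>k\<close>.\<close>

lemma sum_diff_power_if_power_sums_0:
  fixes R B :: "'a::field set"
  assumes "0 < k" "\<And>j. 0 < j \<Longrightarrow> j < k \<Longrightarrow> (\<Sum>b\<in>B. b ^ j) = 0"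
  shows "(\<Sum>b\<in>B. \<Sum>r\<in>R. (b - r) ^ k)
    = of_nat (card R) * (\<Sum>b\<in>B. b ^ k) + (-1) ^ k * of_nat (card B) * (\<Sum>r\<in>R. r ^ k)"
proof -
  have neg: "(\<Sum>r\<in>R. (- r) ^ k) = (-1) ^ k * (\<Sum>r\<in>R. r ^ k)"
    unfolding sum_distrib_left by (intro sum.cong refl power_minus)
  have "(\<Sum>b\<in>B. \<Sum>r\<in>R. (b - r) ^ k)
      = (\<Sum>b\<in>B. \<Sum>r\<in>R. \<Sum>j\<le>k. of_nat (k choose j) * b ^ j * (- r) ^ (k - j))"
    by (intro sum.cong refl) (subst binomial_ring[symmetric], simp)
  also have "\<dots> = (\<Sum>j\<le>k. of_nat (k choose j) * (\<Sum>b\<in>B. b ^ j) * (\<Sum>r\<in>R. (- r) ^ (k - j)))"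
    by (simp only: sum.swap[of _ "{..k}" R] sum.swap[of _ "{..k}" B] mult.assoc sum_product)
       (simp only: sum_distrib_left)
  also have "\<dots> = (\<Sum>j\<in>{0, k}. of_nat (k choose j) * (\<Sum>b\<in>B. b ^ j) * (\<Sum>r\<in>R. (- r) ^ (k - j)))"
    by (rule sum.mono_neutral_right) (use assms(2) in auto)
  also have "\<dots> = of_nat (card R) * (\<Sum>b\<in>B. b ^ k) + (-1) ^ k * of_nat (card B) * (\<Sum>r\<in>R. r ^ k)"
    using assms(1) neg by simp
  finally show ?thesis .
qed

section \<open>The first nontrivial coefficient of the differential identity\<close>

text \<open>In the convolution, indices above \<open>m\<close> or below \<open>m - k\<close> vanish
  by degree, those strictly between by the gap in \<open>f\<close>.\<close>

lemma coeff_mult_sub_leading: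
  fixes f g :: "'a::comm_semiring_0 poly"
  assumes "degree f \<le> m" "degree g \<le> n" "0 < k" "k \<le> m" "k \<le> n"
    and "\<And>j. 0 < j \<Longrightarrow> j < k \<Longrightarrow> coeff f (m - j) = 0"
  shows "coeff (f * g) (m + n - k) = coeff f (m - k) * coeff g n + coeff f m * coeff g (n - k)"
proof -
  have "coeff (f * g) (m + n - k) = (\<Sum>i\<in>{m - k, m}. coeff f i * coeff g (m + n - k - i))"
    unfolding coeff_mult
  proof (rule sum.mono_neutral_right)
    show "\<forall>i\<in>{..m + n - k} - {m - k, m}. coeff f i * coeff g (m + n - k - i) = 0"
    proof
      fix i assume i: "i \<in> {..m + n - k} - {m - k, m}"
      consider "i > m" | "i < m - k" | "m - k < i" "i < m" using i by force
      then show "coeff f i * coeff g (m + n - k - i) = 0"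
      proof cases
        case 3
        then have "coeff f (m - (m - i)) = 0" by (intro assms) auto
        then show ?thesis using 3 by simp
      qed (use assms in \<open>auto simp: coeff_eq_0\<close>)
    qed
  qed (use assms in auto)
  also have "\<dots> = coeff f (m - k) * coeff g n + coeff f m * coeff g (n - k)"
    using assms by (subst sum.insert) auto
  finally show ?thesis .
qed

text \<open>This is the coefficient of degree \<open>m + n - k - 2\<close>, the first below the top
  one that can involve lower coefficients of \<open>f\<close> and \<open>g\<close>.\<close>

lemma coeff_differential_identity:
  fixes f g :: "'a::field poly"
  assumes ode: "smult M (f * pderiv (pderiv g)) + smult N (pderiv (pderiv f) * g)
      = smult E (pderiv f * pderiv g)"
    and deg: "degree f \<le> m" "degree g \<le> n" and k: "0 < k" "k \<le> m" "k \<le> n"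
    and gap: "\<And>j. 0 < j \<Longrightarrow> j < k \<Longrightarrow> coeff f (m - j) = 0"
      "\<And>j. 0 < j \<Longrightarrow> j < k \<Longrightarrow> coeff g (n - j) = 0"
    and monic: "coeff f m = 1" "coeff g n = 1"
  defines "\<phi> \<equiv> coeff f (m - k)" and "\<gamma> \<equiv> coeff g (n - k)"
    and "x \<equiv> of_nat m" and "y \<equiv> of_nat n" and "z \<equiv> of_nat k"
  shows "M * (\<phi> * (y * (y - 1)) + (y - z) * (y - z - 1) * \<gamma>)
       + N * ((x - z) * (x - z - 1) * \<phi> + x * (x - 1) * \<gamma>)
       = E * ((x - z) * \<phi> * y + x * ((y - z) * \<gamma>))"
proof -
  \<comment> \<open>Multiplying by \<open>x\<^sup>2\<close> makes the differential operators diagonal on coefficients.\<close>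
  define D1 D2 :: "'a poly \<Rightarrow> 'a poly"
    where "D1 = (\<lambda>p. pCons 0 (pderiv p))" and "D2 = (\<lambda>p. pCons 0 (pCons 0 (pderiv (pderiv p))))"
  have c1: "coeff (D1 p) i = of_nat i * coeff p i" for p i
    by (auto simp: D1_def coeff_pCons coeff_pderiv split: nat.splits)
  have c2: "coeff (D2 p) i = of_nat i * (of_nat i - 1) * coeff p i" for p i
    by (auto simp: D2_def coeff_pCons coeff_pderiv algebra_simps split: nat.splits)
  have dD: "degree (D1 p) \<le> j" "degree (D2 p) \<le> j" if "degree p \<le> j" for p j
    using that by (auto intro!: degree_le simp: c1 c2 coeff_eq_0)
  have xk: "of_nat (m - k) = x - z" "of_nat (n - k) = y - z"
    using k by (simp_all add: x_def y_def z_def of_nat_diff)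
  have "smult M (f * D2 g) + smult N (D2 f * g) = monom 1 2 *
      (smult M (f * pderiv (pderiv g)) + smult N (pderiv (pderiv f) * g))"
    by (simp add: D2_def monom_altdef numeral_2_eq_2 algebra_simps)
  also have "\<dots> = smult E (D1 f * D1 g)"
    unfolding ode by (simp add: D1_def monom_altdef numeral_2_eq_2 algebra_simps)
  finally have "coeff (smult M (f * D2 g) + smult N (D2 f * g)) (m + n - k)
      = coeff (smult E (D1 f * D1 g)) (m + n - k)" by simp
  moreover have "coeff (f * D2 g) (m + n - k)
      = coeff f (m - k) * coeff (D2 g) n + coeff f m * coeff (D2 g) (n - k)"
    by (intro coeff_mult_sub_leading) (use deg k gap dD in auto)
  moreover have "coeff (D2 f * g) (m + n - k)
      = coeff (D2 f) (m - k) * coeff g n + coeff (D2 f) m * coeff g (n - k)"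
    by (intro coeff_mult_sub_leading) (use deg k gap dD in \<open>auto simp: c2\<close>)
  moreover have "coeff (D1 f * D1 g) (m + n - k)
      = coeff (D1 f) (m - k) * coeff (D1 g) n + coeff (D1 f) m * coeff (D1 g) (n - k)"
    by (intro coeff_mult_sub_leading) (use deg k gap dD in \<open>auto simp: c1\<close>)
  ultimately show ?thesis
    by (simp add: c1 c2 xk monic \<phi>_def[symmetric] \<gamma>_def[symmetric] x_def[symmetric] y_def[symmetric])
qed

section \<open>Equality of the cardinalities\<close>

text \<open>
  The centring excludes \<open>k = 1\<close>, for which the odd case below carries no information.
\<close>

lemma card_eq_if_centred_difference_set:
  fixes R B :: "'a::field set" and c :: 'a and d :: nat
  assumes card: "2 \<le> card R" "2 \<le> card B" "card R * card B = d"
    and pow: "\<And>r b. r \<in> R \<Longrightarrow> b \<in> B \<Longrightarrow> (b - r) ^ d = c"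
    and c: "c \<noteq> 0" and char: "2 * d < CHAR('a)"
    and centred: "\<Sum>R = 0"
    and sums: "\<And>k. 0 < k \<Longrightarrow> k < d \<Longrightarrow> (\<Sum>b\<in>B. \<Sum>r\<in>R. (b - r) ^ k) = 0"
  shows "card R = card B"
proof -
  define m n where "m = card R" and "n = card B"
  define f g where "f = root_poly R" and "g = root_poly B"
  define P Q where "P = (\<lambda>k. \<Sum>r\<in>R. r ^ k)" and "Q = (\<lambda>k. \<Sum>b\<in>B. b ^ k)"
  have fin: "finite R" "finite B"
    using card by (auto intro: card_ge_0_finite)
  have ne: "R \<noteq> {}" "B \<noteq> {}" using card by auto
  have mn: "2 \<le> m" "2 \<le> n" "m * n = d" using card by (simp_all add: m_def n_def)
  have "m * 2 \<le> m * n" "2 * n \<le> m * n"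
    using mn by (intro mult_le_mono; simp)+
  then have le: "2 * m \<le> d" "2 * n \<le> d" "4 \<le> d" using mn by linarith+
  have nz: "of_nat k \<noteq> (0 :: 'a)" if "0 < k" "k < 2 * d" for k
    using that char by (intro of_nat_neq_0_if_less_CHAR) auto

  \<comment> \<open>If the first \<open>m\<close> power sums of \<open>R\<close> vanished, Newton's
    identities would give \<open>f = X ^ m\<close> and so leave \<open>R\<close> at most one
    element.\<close>
  have "\<exists>k. 0 < k \<and> k \<le> m \<and> P k \<noteq> 0"
  proof (rule ccontr)
    assume "\<not> ?thesis"
    then have P0: "P k = 0" if "0 < k" "k \<le> m" for k using that by auto
    have cf: "coeff (reflect_poly f) k = 0" if "0 < k" "k \<le> m" for k
      using coeff_reflect_root_poly_if_power_sums_0[OF fin(1) that(1)] P0 that nz[of k] le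
      by (auto simp: P_def f_def)
    have "f = monom 1 m"
    proof (rule poly_eqI)
      fix i
      consider "i > m" | "i = m" | "i < m" by linarith
      then show "coeff f i = coeff (monom 1 m) i"
      proof cases
        case 1
        then show ?thesis by (simp add: f_def m_def coeff_eq_0)
      next
        case 3
        then show ?thesis using cf[of "m - i"] by (simp add: coeff_reflect_root_poly f_def m_def)
      qed (simp add: f_def m_def)
    qed
    then have "r = 0" if "r \<in> R" for r
      using that poly_root_poly_eq_0_iff[OF fin(1), of r] by (simp add: f_def poly_monom)
    then have "R \<subseteq> {0}" by auto
    then have "card R \<le> 1" using card_mono[of "{0}" R] by simp
    with card show False by simp
  qed
  then obtain k0 where k0: "0 < k0" "k0 \<le> m" "P k0 \<noteq> 0" by blast
  define k where "k = (LEAST k. 0 < k \<and> (P k \<noteq> 0 \<or> Q k \<noteq> 0))"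
  have k: "0 < k" "P k \<noteq> 0 \<or> Q k \<noteq> 0" "k \<le> m"
    using LeastI[of "\<lambda>k. 0 < k \<and> (P k \<noteq> 0 \<or> Q k \<noteq> 0)" k0]
      Least_le[of "\<lambda>k. 0 < k \<and> (P k \<noteq> 0 \<or> Q k \<noteq> 0)" k0] k0
    by (auto simp: k_def)
  have low: "P j = 0" "Q j = 0" if "0 < j" "j < k" for j
    using not_less_Least[of j "\<lambda>k. 0 < k \<and> (P k \<noteq> 0 \<or> Q k \<noteq> 0)"] that
    by (auto simp: k_def)
  have rel: "of_nat m * Q k + (-1) ^ k * of_nat n * P k = 0"
    using sums[of k] sum_diff_power_if_power_sums_0[of k B R] low k le
    by (simp add: P_def Q_def m_def n_def)
  have mn0: "of_nat m \<noteq> (0 :: 'a)" "of_nat n \<noteq> (0 :: 'a)" "of_nat k \<noteq> (0 :: 'a)"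
    using nz[of m] nz[of n] nz[of k] mn le k by auto
  have PQ: "P k \<noteq> 0" "Q k \<noteq> 0" using rel mn0 k(2) by auto
  have "k \<noteq> 1" using PQ centred by (auto simp: P_def)
  with k have "2 \<le> k" by simp

  have newton: "of_nat j * coeff (reflect_poly f) j = - P j"
    "of_nat j * coeff (reflect_poly g) j = - Q j" if "0 < j" "j \<le> k" for j
    unfolding f_def g_def P_def Q_def
    by (rule coeff_reflect_root_poly_if_power_sums_0; use low that fin in \<open>simp add: P_def Q_def\<close>)+
  note cf = newton[OF k(1) order.refl]
  \<comment> \<open>\<open>Q k \<noteq> 0\<close> forces a nonzero coefficient of index
    \<open>k\<close> in the reflected \<open>g\<close>, which has degree at most
    \<open>n\<close>.\<close>
  have "k \<le> n"
  proof (rule ccontr)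
    assume "\<not> k \<le> n"
    then have "coeff (reflect_poly g) k = 0" by (simp add: coeff_reflect_root_poly g_def n_def)
    with cf PQ show False by simp
  qed
  have gap: "coeff f (m - j) = 0" "coeff g (n - j) = 0" if "0 < j" "j < k" for j
  proof -
    have "of_nat j \<noteq> (0 :: 'a)" using nz[of j] that k le by auto
    then show "coeff f (m - j) = 0" "coeff g (n - j) = 0"
      using newton[of j] low[OF that] that k \<open>k \<le> n\<close> by (simp_all add: coeff_reflect_root_poly f_def g_def m_def n_def)
  qed
  define x y z :: 'a where "x = of_nat m" and "y = of_nat n" and "z = of_nat k"
  define \<phi> \<gamma> where "\<phi> = coeff f (m - k)" and "\<gamma> = coeff g (n - k)"
  have cf': "z * \<phi> = - P k" "z * \<gamma> = - Q k"
    using cf k \<open>k \<le> n\<close>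
    by (simp_all add: coeff_reflect_root_poly f_def g_def m_def n_def z_def \<phi>_def \<gamma>_def)
  then have "\<phi> \<noteq> 0" using PQ by auto
  have "z * (x * \<gamma> + (-1) ^ k * y * \<phi>) = x * (z * \<gamma>) + (-1) ^ k * y * (z * \<phi>)"
    by (simp add: algebra_simps)
  also have "\<dots> = - (of_nat m * Q k + (-1) ^ k * of_nat n * P k)"
    unfolding cf' by (simp add: x_def y_def)
  also have "\<dots> = 0" using rel by simp
  finally have rel': "x * \<gamma> + (-1) ^ k * y * \<phi> = 0" using mn0 by (simp add: z_def)

  have d1: "of_nat (2 * (d - 1)) = 2 * (x * y - 1)"
    using mn le by (simp add: x_def y_def of_nat_diff flip: mn(3))
  have ode: "smult (of_nat (m * (m + 1))) (f * pderiv (pderiv g))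
    + smult (of_nat (n * (n + 1))) (pderiv (pderiv f) * g)
    = smult (of_nat (2 * (d - 1))) (pderiv f * pderiv g)"
    unfolding f_def g_def m_def n_def
    by (rule root_poly_differential_identity[OF fin ne pow c])
       (use le mn char in \<open>auto simp: m_def n_def\<close>)
  have deg: "degree f \<le> m" "degree g \<le> n" "coeff f m = 1" "coeff g n = 1"
    by (simp_all add: f_def g_def m_def n_def)
  have eq: "x * (x + 1) * (\<phi> * (y * (y - 1)) + (y - z) * (y - z - 1) * \<gamma>)
       + y * (y + 1) * ((x - z) * (x - z - 1) * \<phi> + x * (x - 1) * \<gamma>)
       = 2 * (x * y - 1) * ((x - z) * \<phi> * y + x * ((y - z) * \<gamma>))"
    using coeff_differential_identity[OF ode deg(1,2) k(1,3) \<open>k \<le> n\<close> gap deg(3,4)]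
    unfolding d1 by (simp add: x_def y_def z_def \<phi>_def \<gamma>_def algebra_simps)
  \<comment> \<open>\<open>w\<close> is the coefficient of \<open>\<gamma>\<close> in
    \<open>u - v\<close>. Subtracting \<open>w\<close> times the linear relation from
    \<open>x * (u - v)\<close> eliminates \<open>\<gamma>\<close>, and what is left factors.\<close>
  define u v w where "u = x * (x + 1) * (\<phi> * (y * (y - 1)) + (y - z) * (y - z - 1) * \<gamma>)
       + y * (y + 1) * ((x - z) * (x - z - 1) * \<phi> + x * (x - 1) * \<gamma>)"
    and "v = 2 * (x * y - 1) * ((x - z) * \<phi> * y + x * ((y - z) * \<gamma>))"
    and "w = x * (x + 1) * (y - z) * (y - z - 1) + y * (y + 1) * x * (x - 1) - 2 * (x * y - 1) * x * (y - z)"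
  have uv: "u = v" using eq by (simp only: u_def v_def)
  show ?thesis
  proof (cases "even k")
    case True
    with rel' have xg: "x * \<gamma> + y * \<phi> = 0" by simp
    have "\<phi> * (x * y * z * (y - x) * (z + 3)) = x * (u - v) - (x * \<gamma> + y * \<phi>) * w"
      unfolding u_def v_def w_def by (simp add: algebra_simps)
    then have "\<phi> * (x * y * z * (y - x) * (z + 3)) = 0" by (simp only: uv xg) simp
    moreover have "z + 3 \<noteq> 0"
      using nz[of "k + 3"] k le by (simp add: z_def)
    ultimately have "x = y"
      using \<open>\<phi> \<noteq> 0\<close> mn0 by (simp add: x_def y_def z_def)
    \<comment> \<open>Equality in the field is only a congruence; both cardinalities lie below the
      characteristic.\<close>
    then have "[m = n] (mod CHAR('a))"
      by (simp add: x_def y_def of_nat_eq_iff_cong_CHAR)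
    then have "m = n"
      using le char by (intro cong_less_modulus_unique_nat[of m n "CHAR('a)"]) auto
    then show ?thesis by (simp add: m_def n_def)
  next
    case False
    with rel' have xg: "x * \<gamma> - y * \<phi> = 0" by simp
    have "\<phi> * (x * y * z * (z - 1) * (x + y + 2)) = x * (u - v) - (x * \<gamma> - y * \<phi>) * w"
      unfolding u_def v_def w_def by (simp add: algebra_simps)
    then have "\<phi> * (x * y * z * (z - 1) * (x + y + 2)) = 0" by (simp only: uv xg) simp
    moreover have "x + y + 2 \<noteq> 0"
      using nz[of "m + n + 2"] le by (simp add: x_def y_def add_ac)
    moreover have "z - 1 \<noteq> 0"
      using nz[of "k - 1"] \<open>2 \<le> k\<close> k le by (simp add: z_def of_nat_diff)
    ultimately show ?thesis
      using \<open>\<phi> \<noteq> 0\<close> mn0 by (simp add: x_def y_def z_def)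
  qed
qed

section \<open>Roots of unity in a finite field\<close>

text \<open>\<open>X ^ d - 1\<close> divides \<open>X ^ (q - 1) - 1\<close>, which vanishes at all
  nonzero elements. The cofactor \<open>h\<close> accounts for at most \<open>q - 1 - d\<close> of
  them.\<close>

lemma card_roots_of_unity:
  assumes "d dvd CARD('a::finite_field) - 1"
  shows "card (roots_of_unity d :: 'a set) = d"
proof -
  let ?q = "CARD('a)" and ?U = "roots_of_unity d :: 'a set"
  obtain e where e: "?q - 1 = d * e" using assms by auto
  have q: "2 \<le> ?q"
    using card_mono[of UNIV "{0, 1 :: 'a}"] by simp
  then have de: "0 < d" "0 < e" using e by (auto intro!: Nat.gr0I)
  define p h :: "'a poly" where "p = monom 1 d - 1" and "h = (\<Sum>i<e. monom 1 (d * i))"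
  have ph: "p * h = monom 1 (?q - 1) - 1"
    unfolding p_def h_def e using power_diff_1_eq[of "monom 1 d :: 'a poly" e]
    by (simp add: monom_power)
  have deg_sub_1: "degree (monom 1 j - 1 :: 'a poly) = j" if "0 < j" for j
    unfolding diff_conv_add_uminus using that by (subst degree_add_eq_left) (auto simp: degree_monom_eq)
  have deg: "degree p = d" unfolding p_def using de by (intro deg_sub_1)
  have "p \<noteq> 0" using deg de by auto
  have "coeff h 0 \<noteq> 0"
    using de by (auto simp: h_def coeff_sum)
  then have "h \<noteq> 0" by auto
  have "degree (p * h) = ?q - 1"
    unfolding ph using q by (intro deg_sub_1) simp
  then have dh: "d + degree h = ?q - 1"
    using \<open>p \<noteq> 0\<close> \<open>h \<noteq> 0\<close> deg by (simp add: degree_mult_eq)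
  have U: "{x. poly p x = 0} = ?U"
    by (auto simp: p_def roots_of_unity_def poly_monom)
  have "x ^ (?q - 1) = 1" if "x \<noteq> 0" for x :: 'a
  proof -
    have "x * x ^ (?q - 1) = x"
      using finite_field_power_card_eq_same[of x] q by (metis power_Suc Suc_diff_1 zero_less_card_finite)
    then show ?thesis using that by simp
  qed
  then have "poly (p * h) x = 0" if "x \<noteq> 0" for x
    using that unfolding ph by (simp add: poly_monom)
  then have "UNIV - {0} \<subseteq> {x. poly p x = 0} \<union> {x. poly h x = 0}" by auto
  then have "card (UNIV - {0 :: 'a}) \<le> card ({x. poly p x = 0} \<union> {x. poly h x = 0})"
    by (intro card_mono) auto
  also have "\<dots> \<le> card {x. poly p x = 0} + card {x. poly h x = 0}" by (rule card_Un_le)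
  also have "\<dots> \<le> card ?U + degree h"
    using card_poly_roots_bound[OF \<open>h \<noteq> 0\<close>] by (simp add: U)
  finally have "d \<le> card ?U" using dh by simp
  moreover have "card ?U \<le> d"
    using card_poly_roots_bound[OF \<open>p \<noteq> 0\<close>] by (simp add: U deg)
  ultimately show ?thesis by simp
qed

text \<open>The root polynomial is \<open>X ^ d - 1\<close>, whose intermediate coefficients vanish,
  so Newton's identities apply.\<close>

lemma power_sum_roots_of_unity:
  assumes "card (roots_of_unity d :: 'a::field set) = d" "0 < k" "k < d"
  shows "(\<Sum>u\<in>roots_of_unity d. u ^ k) = (0 :: 'a)"
proof -
  let ?U = "roots_of_unity d :: 'a set"
  have fin: "finite ?U" using assms by (intro card_ge_0_finite) auto
  have "root_poly ?U = monom 1 d - 1"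
  proof (rule poly_eqI_degree_lead_coeff[of _ d _ ?U])
    show "coeff (root_poly ?U) d = coeff (monom 1 d - 1) d"
      using coeff_root_poly_card[of ?U] assms by simp
    fix u assume u: "u \<in> ?U"
    then show "poly (root_poly ?U) u = poly (monom 1 d - 1) u"
      using poly_root_poly_eq_0_iff[OF fin, of u] by (simp add: roots_of_unity_def poly_monom)
  qed (use assms in \<open>auto intro!: degree_diff_le simp: degree_monom_le\<close>)
  then have "coeff (reflect_poly (root_poly ?U)) j = 0" if "0 < j" "j \<le> k" for j
    unfolding coeff_reflect_root_poly using that assms by simp
  then show ?thesis
    using assms by (intro power_sum_eq_0_if_coeff_reflect_root_poly_0 fin) auto
qed

section \<open>Application to sumsets\<close>

lemma card_summands_of_roots_of_unity:
  fixes A B :: "'a::field set"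
  assumes AB: "A + B = roots_of_unity d" and U: "card (roots_of_unity d :: 'a set) = d"
    and card: "2 \<le> card A" "2 \<le> card B" and char: "2 * d < CHAR('a)"
  shows "card A = card B \<and> card A * card B = d"
proof -
  let ?U = "roots_of_unity d :: 'a set"
  have fin: "finite A" "finite B" using card by (auto intro: card_ge_0_finite)
  have ne: "A \<noteq> {}" "B \<noteq> {}" using card by auto
  have img: "(\<lambda>(a, b). a + b) ` (A \<times> B) = ?U"
    unfolding AB[symmetric] by (rule set_plus_image[symmetric])
  have finU: "finite ?U" unfolding img[symmetric] using fin by simp
  have pow: "(b + a) ^ d = 1" if "a \<in> A" "b \<in> B" for a b
    using set_plus_intro[OF that] unfolding AB by (simp add: roots_of_unity_def add.commute)
  obtain b where "b \<in> B" using ne by auto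
  then have "(\<lambda>a. a + b) ` A \<subseteq> ?U" unfolding AB[symmetric] by auto
  then have "card A \<le> card ?U"
    using card_mono[OF finU, of "(\<lambda>a. a + b) ` A"] by (simp add: card_image inj_on_def)
  then have d: "card A \<le> d" using U by simp

  have "card (uminus ` A) * card B \<le> d"
    by (rule card_mult_card_le[where c = 1])
       (use fin ne pow card d char in \<open>auto simp: card_image inj_on_def\<close>)
  then have "card A * card B \<le> d" by (simp add: card_image inj_on_def)
  moreover have "d \<le> card (A \<times> B)"
    using card_image_le[of "A \<times> B" "\<lambda>(a, b). a + b"] fin U unfolding img by simp
  ultimately have mn: "card A * card B = d" by (simp add: card_cartesian_product)
  \<comment> \<open>Equal cardinalities make addition a bijection from \<open>A \<times> B\<close>
    onto the roots of unity, so power sums over pairs become power sums of roots of unity.\<close>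
  then have inj: "inj_on (\<lambda>(a, b). a + b) (A \<times> B)"
    using fin U by (intro eq_card_imp_inj_on) (auto simp: img card_cartesian_product)

  \<comment> \<open>\<open>t\<close> is the mean of \<open>-A\<close>. Shifting \<open>-A\<close>
    and \<open>B\<close> by the same amount centres the former and preserves all
    differences.\<close>
  define t where "t = (\<Sum>a\<in>A. - a) / of_nat (card A)"
  define R' B' where "R' = (\<lambda>a. - a - t) ` A" and "B' = (\<lambda>b. b - t) ` B"
  have injs: "inj_on (\<lambda>a. - a - t) A" "inj_on (\<lambda>b. b - t) B" by (auto simp: inj_on_def)
  have cards: "card R' = card A" "card B' = card B"
    unfolding R'_def B'_def using injs by (simp_all add: card_image)
  have "of_nat (card A) \<noteq> (0 :: 'a)"
    using card d char by (intro of_nat_neq_0_if_less_CHAR) auto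
  then have "\<Sum>R' = 0"
    unfolding R'_def sum.reindex[OF injs(1)] by (simp add: sum_subtractf t_def)
  moreover have "(\<Sum>b\<in>B'. \<Sum>r\<in>R'. (b - r) ^ k) = 0" if k: "0 < k" "k < d" for k
  proof -
    have "(\<Sum>b\<in>B'. \<Sum>r\<in>R'. (b - r) ^ k) = (\<Sum>b\<in>B. \<Sum>a\<in>A. (a + b) ^ k)"
      unfolding R'_def B'_def sum.reindex[OF injs(1)] sum.reindex[OF injs(2)]
      by (simp add: add.commute)
    also have "\<dots> = (\<Sum>(a, b)\<in>A \<times> B. (a + b) ^ k)"
      by (subst sum.swap) (simp add: sum.cartesian_product)
    also have "\<dots> = (\<Sum>u\<in>?U. u ^ k)"
      unfolding img[symmetric] by (subst sum.reindex[OF inj]) (simp add: case_prod_unfold)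
    also have "\<dots> = 0" by (rule power_sum_roots_of_unity[OF U k])
    finally show ?thesis .
  qed
  moreover have "(b - r) ^ d = 1" if "r \<in> R'" "b \<in> B'" for r b
    using that pow by (auto simp: R'_def B'_def)
  ultimately have "card R' = card B'"
    using card mn char by (intro card_eq_if_centred_difference_set[where c = 1 and d = d]) (auto simp: cards)
  then show ?thesis using mn cards by simp
qed

theorem theorem2:
  fixes A B :: "'p::prime_card mod_ring set" and p d :: nat
  assumes "prime p" and "CARD('p) = p"
    and "d dvd p - 1" and "1 < d" and "d < p - 1"
    and "A + B = roots_of_unity d"
    and "card A > 1" and "card B > 1"
  shows "real (card A) = sqrt (real d) \<and> real (card B) = sqrt (real d)"
proof -
  obtain e where e: "p - 1 = d * e" using assms(3) by auto
  \<comment> \<open>A proper divisor of \<open>p - 1\<close> is at most half of it; this supplies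
    the bound \<open>2 * d < p\<close>.\<close>
  have "2 \<le> e"
  proof (rule ccontr)
    assume "\<not> 2 \<le> e"
    then have "e = 0 \<or> e = 1" by auto
    then show False using e assms(5) by auto
  qed
  then have "d * 2 \<le> p - 1" unfolding e by (rule mult_le_mono2)
  then have char: "2 * d < CHAR('p mod_ring)"
    using assms(2,5) by simp
  have "card (roots_of_unity d :: 'p mod_ring set) = d"
    by (rule card_roots_of_unity) (use assms(2,3) in simp)
  then have "card A = card B \<and> card A * card B = d"
    using assms(6,7,8) char by (intro card_summands_of_roots_of_unity) auto
  then have "real d = (real (card A))\<^sup>2" "card B = card A"
    by (auto simp: power2_eq_square)
  then show ?thesis by simp
qed

end
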